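(* $S_o[H^\infty]=S_o[A]=\{0\}$.
   Context: $\mathbb{D}$ is the open unit disk, $H(\mathbb{D})$ the set of analytic functions on $\mathbb{D}$, $H^\infty$ the Banach space of bounded analytic functions on $\mathbb{D}$ with the supremum norm, and $A$ the disk algebra (analytic functions on $\mathbb{D}$ that extend to be continuous on $\overline{\mathbb{D}}$), also with the supremum norm. For $g\in H(\mathbb{D})$, $S_gf(z)=\int_0^z f'(t)g(t)\,dt$ for $z\in\mathbb{D}$, $f\in H(\mathbb{D})$. For a Banach space $X\subseteq H(\mathbb{D})$, $S_o[X]=\{g\in H(\mathbb{D}): S_g\text{ is a compact operator from }X\text{ into }X\}$. *)

theory Defs
  imports "HOL-Complex_Analysis.Complex_Analysis" "HOL-Analysis.Abstract_Metric_Spaces"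
begin

abbreviation unit_disk :: "complex set" where
  "unit_disk \<equiv> ball 0 1"

text \<open>
  A function on the open unit disk is represented by the total function that extends it by
  \<open>0\<close>, so that equality in HOL is equality on the disk and \<open>\<lambda>_. 0\<close> is the only representative
  of the zero function.
\<close>

definition HD :: "(complex \<Rightarrow> complex) set" where
  "HD = {f. f holomorphic_on unit_disk \<and> (\<forall>z. z \<notin> unit_disk \<longrightarrow> f z = 0)}"

definition sup_norm :: "(complex \<Rightarrow> complex) \<Rightarrow> real" where
  "sup_norm f = (SUP z\<in>unit_disk. cmod (f z))"

definition H_infty :: "(complex \<Rightarrow> complex) set" where
  "H_infty = {f \<in> HD. bounded (f ` unit_disk)}"

text \<open>
  The continuous extension \<open>F\<close> to the closed disk is a separate function: the values of \<open>f\<close>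
  itself on the unit circle are \<open>0\<close> by convention.
\<close>

definition disk_algebra :: "(complex \<Rightarrow> complex) set" where
  "disk_algebra =
    {f \<in> HD. \<exists>F. continuous_on (cball 0 1) F \<and> (\<forall>z\<in>unit_disk. F z = f z)}"

definition S_op :: "(complex \<Rightarrow> complex) \<Rightarrow> (complex \<Rightarrow> complex) \<Rightarrow> complex \<Rightarrow> complex" where
  "S_op g f z =
    (if z \<in> unit_disk then contour_integral (linepath 0 z) (\<lambda>t. deriv f t * g t) else 0)"

text \<open>
  A normed space of functions is given by its carrier \<open>X\<close> and its norm \<open>N\<close>. The values of
  \<open>norm_dist\<close> outside \<open>X\<close> are irrelevant; they are \<open>0\<close> because \<^locale>\<open>Metric_space\<close> requires a
  globally nonnegative symmetric distance.
\<close>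

definition norm_dist ::
  "(complex \<Rightarrow> complex) set \<Rightarrow> ((complex \<Rightarrow> complex) \<Rightarrow> real)
    \<Rightarrow> (complex \<Rightarrow> complex) \<Rightarrow> (complex \<Rightarrow> complex) \<Rightarrow> real" where
  "norm_dist X N f h = (if f \<in> X \<and> h \<in> X then N (\<lambda>z. f z - h z) else 0)"

abbreviation norm_topology ::
  "(complex \<Rightarrow> complex) set \<Rightarrow> ((complex \<Rightarrow> complex) \<Rightarrow> real) \<Rightarrow> (complex \<Rightarrow> complex) topology" where
  "norm_topology X N \<equiv> Metric_space.mtopology X (norm_dist X N)"

definition linear_operator ::
  "(complex \<Rightarrow> complex) set \<Rightarrow> ((complex \<Rightarrow> complex) \<Rightarrow> (complex \<Rightarrow> complex)) \<Rightarrow> bool" where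
  "linear_operator X T \<longleftrightarrow>
    T ` X \<subseteq> X \<and>
    (\<forall>f\<in>X. \<forall>h\<in>X. T (\<lambda>z. f z + h z) = (\<lambda>z. T f z + T h z)) \<and>
    (\<forall>c. \<forall>f\<in>X. T (\<lambda>z. c * f z) = (\<lambda>z. c * T f z))"

definition compact_operator ::
  "(complex \<Rightarrow> complex) set \<Rightarrow> ((complex \<Rightarrow> complex) \<Rightarrow> real)
    \<Rightarrow> ((complex \<Rightarrow> complex) \<Rightarrow> (complex \<Rightarrow> complex)) \<Rightarrow> bool" where
  "compact_operator X N T \<longleftrightarrow>
    linear_operator X T \<and>
    compactin (norm_topology X N) (norm_topology X N closure_of (T ` {f \<in> X. N f \<le> 1}))"

definition S_o ::
  "(complex \<Rightarrow> complex) set \<Rightarrow> ((complex \<Rightarrow> complex) \<Rightarrow> real) \<Rightarrow> (complex \<Rightarrow> complex) set" where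
  "S_o X N = {g \<in> HD. compact_operator X N (S_op g)}"

lemma disk_algebra_subset_H_infty: "disk_algebra \<subseteq> H_infty"
proof
  fix f assume "f \<in> disk_algebra"
  then obtain F where f: "f \<in> HD" and F: "continuous_on (cball 0 1) F" "\<forall>z\<in>unit_disk. F z = f z"
    by (auto simp: disk_algebra_def)
  have "bounded (F ` cball 0 1)"
    by (intro compact_imp_bounded compact_continuous_image F) auto
  moreover have "f ` unit_disk \<subseteq> F ` cball 0 1"
  proof (rule image_subsetI)
    fix z :: complex assume z: "z \<in> unit_disk"
    then have "f z = F z" "z \<in> cball 0 1" using F(2) by auto
    then show "f z \<in> F ` cball 0 1" by blast
  qed
  ultimately have "bounded (f ` unit_disk)" by (rule bounded_subset)
  with f show "f \<in> H_infty" by (simp add: H_infty_def)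
qed

lemma cmod_le_sup_norm:
  assumes "bounded (f ` unit_disk)" "z \<in> unit_disk"
  shows "cmod (f z) \<le> sup_norm f"
proof -
  from assms(1) obtain B where "\<forall>z\<in>unit_disk. cmod (f z) \<le> B"
    by (auto simp: bounded_iff)
  then have "bdd_above ((\<lambda>z. cmod (f z)) ` unit_disk)"
    by (intro bdd_aboveI2) auto
  then show ?thesis
    unfolding sup_norm_def using assms(2) by (intro cSUP_upper)
qed

lemma Metric_space_sup_norm:
  assumes "X \<subseteq> H_infty"
  shows "Metric_space X (norm_dist X sup_norm)"
proof
  have bd: "bounded ((\<lambda>z. f z - h z) ` unit_disk)" if "f \<in> X" "h \<in> X" for f h
    using that assms by (intro bounded_minus_comp) (auto simp: H_infty_def)
  have le: "cmod (f z - h z) \<le> sup_norm (\<lambda>z. f z - h z)"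
    if "f \<in> X" "h \<in> X" "z \<in> unit_disk" for f h z
    using cmod_le_sup_norm[OF bd that(3)] that by simp
  fix f h k
  show "0 \<le> norm_dist X sup_norm f h"
    using order_trans[OF norm_ge_zero le[of f h 0]] by (auto simp: norm_dist_def)
  show "norm_dist X sup_norm f h = norm_dist X sup_norm h f"
    by (simp add: norm_dist_def sup_norm_def norm_minus_commute)
  assume X: "f \<in> X" "h \<in> X"
  show "norm_dist X sup_norm f h = 0 \<longleftrightarrow> f = h"
  proof
    assume "norm_dist X sup_norm f h = 0"
    then have "f z = h z" if "z \<in> unit_disk" for z
      using le[OF X that] X by (simp add: norm_dist_def)
    moreover have "f z = h z" if "z \<notin> unit_disk" for z
    proof -
      have "f \<in> HD" "h \<in> HD" using X assms by (auto simp: H_infty_def)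
      then show ?thesis using that by (simp add: HD_def)
    qed
    ultimately show "f = h" by blast
  qed (simp add: norm_dist_def sup_norm_def)
  assume "k \<in> X"
  have "sup_norm (\<lambda>z. f z - k z) \<le> sup_norm (\<lambda>z. f z - h z) + sup_norm (\<lambda>z. h z - k z)"
    unfolding sup_norm_def[of "\<lambda>z. f z - k z"]
  proof (rule cSUP_least)
    fix z assume z: "z \<in> unit_disk"
    have "cmod (f z - k z) \<le> cmod (f z - h z) + cmod (h z - k z)"
      using norm_triangle_ineq[of "f z - h z" "h z - k z"] by simp
    then show "cmod (f z - k z) \<le> sup_norm (\<lambda>z. f z - h z) + sup_norm (\<lambda>z. h z - k z)"
      using le[OF X z] le[OF X(2) \<open>k \<in> X\<close> z] by linarith
  qed auto
  then show "norm_dist X sup_norm f k \<le> norm_dist X sup_norm f h + norm_dist X sup_norm h k"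
    using X \<open>k \<in> X\<close> by (simp add: norm_dist_def)
qed

end

theory Submission
  imports Defs
begin

text \<open>
  The monomials \<open>z\<^sup>n\<close> witness the failure of compactness. Let \<open>S\<^sub>g\<close> be compact on a space \<open>X\<close>
  between the disk algebra and \<open>H\<^sup>\<infinity>\<close>. The monomials lie in the unit ball of \<open>X\<close>, so some
  subsequence of their images \<open>S\<^sub>g z\<^sup>n\<close> converges in the supremum norm to a function \<open>h\<close> in \<open>X\<close>; let
  \<open>\<epsilon>\<^sub>n\<close> be the distance to \<open>h\<close>. By the Cauchy estimate, norm convergence controls derivatives at
  the rate \<open>1 / (1 - |z|)\<close>, and \<open>(S\<^sub>g z\<^sup>n)' = n z\<^sup>n\<^sup>-\<^sup>1 g\<close>, so that
  \<open>|n z\<^sup>n\<^sup>-\<^sup>1 g z - h' z| (1 - |z|) \<le> \<epsilon>\<^sub>n\<close> at every point of the disk.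

  This inequality is used twice. At a fixed point \<open>z\<close> the factor \<open>n z\<^sup>n\<^sup>-\<^sup>1\<close> and \<open>\<epsilon>\<^sub>n\<close> tend to \<open>0\<close>,
  which forces \<open>h' z = 0\<close>. On the circle \<open>|z| = 1 - 1/n\<close>, where \<open>n |z|\<^sup>n\<^sup>-\<^sup>1 (1 - |z|)\<close> stays above \<open>1/e\<close>, it then
  gives \<open>|g| \<le> e \<epsilon>\<^sub>n\<close>. By the maximum principle the same bound holds inside these circles, which
  exhaust the disk, and therefore \<open>g = 0\<close>.

  Both spaces of the theorem are extreme cases of such an \<open>X\<close>. Conversely, \<open>g = 0\<close> gives the zero
  operator, whose image of the unit ball is a single point.
\<close>

lemma contour_integral_linepath_has_field_derivative:
  assumes f: "f holomorphic_on S" and S: "open S" "convex S" and "a \<in> S" "z \<in> S"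
  shows "((\<lambda>w. contour_integral (linepath a w) f) has_field_derivative f z) (at z)"
proof -
  obtain F where F: "\<And>x. x \<in> S \<Longrightarrow> (F has_field_derivative f x) (at x within S)"
    using holomorphic_convex_primitive'[OF S(2,1) f] by blast
  have eq: "F w - F a = contour_integral (linepath a w) f" if "w \<in> S" for w
  proof -
    have "path_image (linepath a w) \<subseteq> S"
      using closed_segment_subset[OF \<open>a \<in> S\<close> that S(2)] by simp
    with F have "(f has_contour_integral (F (pathfinish (linepath a w))
        - F (pathstart (linepath a w)))) (linepath a w)"
      by (intro contour_integral_primitive[of S F f]) auto
    then show ?thesis by (simp add: contour_integral_unique)
  qed
  have "(F has_field_derivative f z) (at z)"
    using F[OF \<open>z \<in> S\<close>] at_within_open[OF \<open>z \<in> S\<close> S(1)] by simp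
  then have "((\<lambda>w. F w - F a) has_field_derivative f z) (at z)"
    by (auto intro!: derivative_eq_intros)
  then show ?thesis
    by (rule has_field_derivative_transform_within_open[OF _ S(1) \<open>z \<in> S\<close> eq])
qed

lemma S_op_has_field_derivative:
  assumes "f \<in> HD" "g \<in> HD" "z \<in> unit_disk"
  shows "(S_op g f has_field_derivative deriv f z * g z) (at z)"
proof -
  have "(\<lambda>t. deriv f t * g t) holomorphic_on unit_disk"
    using assms(1,2) by (auto simp: HD_def intro!: holomorphic_intros)
  then have "((\<lambda>w. contour_integral (linepath 0 w) (\<lambda>t. deriv f t * g t))
      has_field_derivative deriv f z * g z) (at z)"
    using assms(3) by (intro contour_integral_linepath_has_field_derivative) auto
  then show ?thesis
    by (rule has_field_derivative_transform_within_open[OF _ open_ball assms(3)])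
      (simp add: S_op_def)
qed

text \<open>
  The Cauchy inequality on circles about \<open>z\<close> whose radius increases to \<open>1 - |z|\<close>.
\<close>

lemma cmod_deriv_le_sup_norm:
  assumes f: "f holomorphic_on unit_disk" "bounded (f ` unit_disk)" and z: "z \<in> unit_disk"
  shows "cmod (deriv f z) * (1 - cmod z) \<le> sup_norm f"
proof (rule field_le_mult_one_interval)
  fix t :: real assume t: "0 < t" "t < 1"
  define R where "R = t * (1 - cmod z)"
  have R: "0 < R" "R < 1 - cmod z" using t z by (auto simp: R_def)
  have sub: "cball z R \<subseteq> unit_disk"
  proof
    fix x assume "x \<in> cball z R"
    then have "cmod (x - z) \<le> R" by (simp add: dist_norm norm_minus_commute)
    then show "x \<in> unit_disk" using norm_triangle_sub[of x z] R by simp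
  qed
  have holo: "f holomorphic_on cball z R" by (rule holomorphic_on_subset[OF f(1) sub])
  have "cmod ((deriv ^^ 1) f z) \<le> fact 1 * sup_norm f / R ^ 1"
  proof (rule Cauchy_inequality)
    show "f holomorphic_on ball z R" by (rule holomorphic_on_subset[OF holo ball_subset_cball])
    show "continuous_on (cball z R) f" by (rule holomorphic_on_imp_continuous_on[OF holo])
    show "cmod (f x) \<le> sup_norm f" if "cmod (z - x) = R" for x
      using that sub by (intro cmod_le_sup_norm f(2)) (auto simp: dist_norm)
  qed (rule R)
  then show "t * (cmod (deriv f z) * (1 - cmod z)) \<le> sup_norm f"
    using R by (simp add: R_def field_simps)
qed

definition disk_monomial :: "nat \<Rightarrow> complex \<Rightarrow> complex" where
  "disk_monomial n z = (if z \<in> unit_disk then z ^ n else 0)"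

lemma disk_monomial_in_disk_algebra: "disk_monomial n \<in> disk_algebra"
proof -
  have "disk_monomial n holomorphic_on unit_disk \<longleftrightarrow> (\<lambda>z. z ^ n) holomorphic_on unit_disk"
    by (intro holomorphic_cong) (auto simp: disk_monomial_def)
  then have "disk_monomial n \<in> HD"
    by (auto simp: HD_def disk_monomial_def intro!: holomorphic_intros)
  moreover have "continuous_on (cball 0 1) (\<lambda>z::complex. z ^ n)"
    by (intro continuous_intros)
  ultimately show ?thesis
    unfolding disk_algebra_def
    by (intro CollectI conjI exI[of _ "\<lambda>z. z ^ n"]) (auto simp: disk_monomial_def)
qed

lemma sup_norm_disk_monomial_le: "sup_norm (disk_monomial n) \<le> 1"
  unfolding sup_norm_def
  by (rule cSUP_least) (auto simp: disk_monomial_def norm_power power_le_one)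

lemma deriv_disk_monomial_Suc:
  assumes "z \<in> unit_disk"
  shows "deriv (disk_monomial (Suc n)) z = of_nat (Suc n) * z ^ n"
proof -
  have "((\<lambda>z. z ^ Suc n) has_field_derivative of_nat (Suc n) * z ^ n) (at z)"
    by (rule DERIV_cong[OF DERIV_power[OF DERIV_ident]]) simp
  then have "(disk_monomial (Suc n) has_field_derivative of_nat (Suc n) * z ^ n) (at z)"
    by (rule has_field_derivative_transform_within_open[OF _ open_ball assms])
      (simp add: disk_monomial_def)
  then show ?thesis by (rule DERIV_imp_deriv)
qed

lemma Suc_mult_power_tendsto_zero:
  fixes z :: complex
  assumes "cmod z < 1"
  shows "(\<lambda>n. of_nat (Suc n) * z ^ n) \<longlonglongrightarrow> 0"
  using tendsto_add[OF powser_times_n_limit_0[OF assms] LIMSEQ_power_zero[OF assms]]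
  by (simp add: algebra_simps)

lemma exp_minus_one_le_power: "exp (- 1) \<le> (real n / real (Suc n)) ^ n"
proof (cases "n = 0")
  case False
  have "(1 + 1 / real n) ^ n \<le> exp (1 / real n) ^ n"
    by (intro power_mono exp_ge_add_one_self) auto
  also have "\<dots> = exp 1" using False by (simp flip: exp_of_nat_mult)
  finally have "inverse (exp 1) \<le> inverse ((1 + 1 / real n) ^ n)"
    by (intro le_imp_inverse_le) (simp_all add: add_pos_nonneg)
  also have "\<dots> = (real n / real (Suc n)) ^ n"
    using False by (simp add: field_simps flip: power_inverse)
  finally show ?thesis by (simp add: exp_minus)
qed simp

text \<open>
  The weight \<open>(n + 1) |z|\<^sup>n (1 - |z|)\<close> tends to \<open>0\<close> at each point, but its maximum over the disk does
  not: on the circle \<open>|z| = n / (n + 1)\<close> it is at least \<open>1/e\<close>. Smallness of the weighted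
  function on these circles propagates inwards by the maximum principle.
\<close>

lemma holomorphic_eq_zero_if_weighted_bound_tendsto_zero:
  assumes g: "g holomorphic_on unit_disk" and r: "strict_mono (r :: nat \<Rightarrow> nat)"
    and \<epsilon>: "\<epsilon> \<longlonglongrightarrow> (0 :: real)"
    and bound: "\<And>k z. z \<in> unit_disk \<Longrightarrow>
      real (Suc (r k)) * cmod z ^ r k * cmod (g z) * (1 - cmod z) \<le> \<epsilon> k"
    and w: "w \<in> unit_disk"
  shows "g w = 0"
proof -
  have circle: "cmod (g z) \<le> exp 1 * \<epsilon> k" if z: "cmod z = real (r k) / real (Suc (r k))" for k z
  proof -
    have *: "real (Suc (r k)) * (1 - cmod z) = 1" using z by (simp add: field_simps)
    have "z \<in> unit_disk" using z by simp
    have "exp (- 1) * cmod (g z) \<le> cmod z ^ r k * cmod (g z)"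
      unfolding z by (intro mult_right_mono exp_minus_one_le_power) simp
    also have "\<dots> = real (Suc (r k)) * (1 - cmod z) * (cmod z ^ r k * cmod (g z))"
      unfolding * by simp
    also have "\<dots> \<le> \<epsilon> k" using bound[OF \<open>z \<in> unit_disk\<close>, of k] by (simp only: mult_ac)
    finally show ?thesis by (simp add: exp_minus field_simps)
  qed
  have "eventually (\<lambda>n. cmod w < real n / real (Suc n)) sequentially"
    using w by (intro order_tendstoD(1)[OF LIMSEQ_n_over_Suc_n]) simp
  then have "eventually (\<lambda>k. cmod w < real (r k) / real (Suc (r k))) sequentially"
    using eventually_subseq[OF r] by blast
  then have "eventually (\<lambda>k. cmod (g w) \<le> exp 1 * \<epsilon> k) sequentially"
  proof (rule eventually_mono)
    fix k assume k: "cmod w < real (r k) / real (Suc (r k))"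
    let ?R = "real (r k) / real (Suc (r k))"
    have "0 < ?R" using k norm_ge_zero[of w] by linarith
    have "?R < 1" by simp
    then have sub: "cball 0 ?R \<subseteq> unit_disk" by (intro cball_subset_ball_iff[THEN iffD2]) simp
    have holo: "g holomorphic_on cball 0 ?R" by (rule holomorphic_on_subset[OF g sub])
    show "cmod (g w) \<le> exp 1 * \<epsilon> k"
    proof (rule maximum_modulus_frontier[of g "cball 0 ?R"])
      show "g holomorphic_on interior (cball 0 ?R)"
        by (rule holomorphic_on_subset[OF holo interior_subset])
      show "continuous_on (closure (cball 0 ?R)) g"
        using holomorphic_on_imp_continuous_on[OF holo] by simp
      show "cmod (g z) \<le> exp 1 * \<epsilon> k" if "z \<in> frontier (cball 0 ?R)" for z
        using that \<open>0 < ?R\<close> by (intro circle) (simp add: dist_norm)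
    qed (use k in auto)
  qed
  moreover have "(\<lambda>k. exp 1 * \<epsilon> k) \<longlonglongrightarrow> 0"
    using tendsto_mult_right_zero[OF \<epsilon>] .
  ultimately have "cmod (g w) \<le> 0"
    by (intro tendsto_lowerbound[where f = "\<lambda>k. exp 1 * \<epsilon> k"]) auto
  then show ?thesis by simp
qed

text \<open>
  The images of the monomials under a compact \<open>S\<^sub>g\<close> have a norm-convergent subsequence, and the
  Cauchy estimate turns this into the weighted bound on \<open>g\<close> required above.
\<close>

lemma compact_S_op_imp_zero:
  assumes X: "disk_algebra \<subseteq> X" "X \<subseteq> H_infty"
    and g: "g \<in> HD" and comp: "compact_operator X sup_norm (S_op g)"
  shows "g = (\<lambda>_. 0)"
proof -
  interpret Metric_space X "norm_dist X sup_norm" by (rule Metric_space_sup_norm[OF X(2)])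
  have HD: "f \<in> HD" and bd: "bounded (f ` unit_disk)" if "f \<in> X" for f
    using that X(2) by (auto simp: H_infty_def)
  define p where "p n = disk_monomial (Suc n)" for n
  define u where "u n = S_op g (p n)" for n
  have p: "p n \<in> X" for n using X(1) disk_monomial_in_disk_algebra by (auto simp: p_def)
  have T: "S_op g ` X \<subseteq> X" using comp by (simp add: compact_operator_def linear_operator_def)
  have u: "u n \<in> X" for n using T p by (auto simp: u_def)
  let ?I = "S_op g ` {f \<in> X. sup_norm f \<le> 1}"
  have "range u \<subseteq> ?I"
    using p sup_norm_disk_monomial_le by (auto simp: u_def p_def)
  also have "?I \<subseteq> mtopology closure_of ?I"
    using T by (intro closure_of_subset) auto
  finally obtain h r where r: "strict_mono r" and lim: "limitin mtopology (u \<circ> r) h sequentially"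
    using comp unfolding compact_operator_def compactin_sequentially by blast
  define \<epsilon> where "\<epsilon> k = norm_dist X sup_norm (u (r k)) h" for k
  have h: "h \<in> X" and \<epsilon>: "\<epsilon> \<longlonglongrightarrow> 0"
    using lim by (simp_all add: limitin_metric_dist_null \<epsilon>_def[abs_def])
  have deriv_u: "(u n has_field_derivative of_nat (Suc n) * z ^ n * g z) (at z)"
    if "z \<in> unit_disk" for n z
    using S_op_has_field_derivative[OF HD[OF p] g that, of n] deriv_disk_monomial_Suc[OF that, of n]
    unfolding u_def p_def by simp
  have main: "cmod (of_nat (Suc (r k)) * z ^ r k * g z - deriv h z) * (1 - cmod z) \<le> \<epsilon> k"
    if z: "z \<in> unit_disk" for k z
  proof -
    let ?f = "\<lambda>z. u (r k) z - h z"
    have "(h has_field_derivative deriv h z) (at z)"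
      using HD[OF h] z by (auto simp: HD_def intro!: holomorphic_derivI[of h unit_disk])
    with deriv_u[OF z] have "deriv ?f z = of_nat (Suc (r k)) * z ^ r k * g z - deriv h z"
      by (intro DERIV_imp_deriv DERIV_diff)
    moreover have "cmod (deriv ?f z) * (1 - cmod z) \<le> sup_norm ?f"
      using HD[OF u] HD[OF h] z
      by (intro cmod_deriv_le_sup_norm bounded_minus_comp bd u h)
        (auto simp: HD_def intro!: holomorphic_intros)
    ultimately show ?thesis using u h by (simp add: \<epsilon>_def norm_dist_def)
  qed
  \<comment> \<open>The limit of the subsequence is constant: let \<open>k\<close> tend to infinity in the estimate at a fixed
    point.\<close>
  have deriv_h: "deriv h z = 0" if z: "z \<in> unit_disk" for z
  proof -
    have "(\<lambda>k. of_nat (Suc (r k)) * z ^ r k) \<longlonglongrightarrow> 0"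
      using LIMSEQ_subseq_LIMSEQ[OF Suc_mult_power_tendsto_zero r] z by (simp add: o_def)
    then have "(\<lambda>k. of_nat (Suc (r k)) * z ^ r k * g z) \<longlonglongrightarrow> 0"
      by (rule tendsto_mult_left_zero)
    then have "(\<lambda>k. cmod (of_nat (Suc (r k)) * z ^ r k * g z - deriv h z) * (1 - cmod z))
        \<longlonglongrightarrow> cmod (0 - deriv h z) * (1 - cmod z)"
      by (intro tendsto_intros)
    then have "cmod (0 - deriv h z) * (1 - cmod z) \<le> 0"
      using \<epsilon> main[OF z] by (intro LIMSEQ_le) auto
    then show ?thesis using z by (auto simp: mult_le_0_iff)
  qed
  have "g z = 0" if "z \<in> unit_disk" for z
  proof (rule holomorphic_eq_zero_if_weighted_bound_tendsto_zero[OF _ r \<epsilon> _ that])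
    show "g holomorphic_on unit_disk" using g by (simp add: HD_def)
    show "real (Suc (r k)) * cmod z ^ r k * cmod (g z) * (1 - cmod z) \<le> \<epsilon> k"
      if "z \<in> unit_disk" for k z
      using main[OF that, of k] deriv_h[OF that]
      by (simp add: norm_mult norm_power del: of_nat_Suc)
  qed
  then show ?thesis using g by (auto simp: HD_def)
qed

lemma compact_S_op_zero:
  assumes X: "X \<subseteq> H_infty" and zero_in: "(\<lambda>_. 0) \<in> X"
  shows "compact_operator X sup_norm (S_op (\<lambda>_. 0))"
proof -
  interpret Metric_space X "norm_dist X sup_norm" by (rule Metric_space_sup_norm[OF X])
  have S: "S_op (\<lambda>_. 0) f = (\<lambda>_. 0)" for f by (simp add: S_op_def fun_eq_iff)
  have "(\<lambda>_. 0) \<in> {f \<in> X. sup_norm f \<le> 1}" using zero_in by (simp add: sup_norm_def)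
  then have "S_op (\<lambda>_. 0) ` {f \<in> X. sup_norm f \<le> 1} = {\<lambda>_. 0}"
    unfolding S by (rule image_constant)
  moreover have "mtopology closure_of {\<lambda>_. 0} = {\<lambda>_. 0}"
    using zero_in Hausdorff_space_mtopology by (simp add: closure_of_eq closedin_Hausdorff_singleton)
  ultimately show ?thesis
    using zero_in by (auto simp: compact_operator_def linear_operator_def S finite_imp_compactin)
qed

lemma zero_in_disk_algebra: "(\<lambda>_. 0) \<in> disk_algebra"
  by (auto simp: disk_algebra_def HD_def intro!: exI[of _ "\<lambda>_. 0"])

lemma S_o_sup_norm_eq:
  assumes X: "disk_algebra \<subseteq> X" "X \<subseteq> H_infty"
  shows "S_o X sup_norm = {\<lambda>_. 0}"
proof -
  have "(\<lambda>_. 0) \<in> X" using X(1) zero_in_disk_algebra by blast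
  then have "(\<lambda>_. 0) \<in> S_o X sup_norm"
    using compact_S_op_zero[OF X(2)] zero_in_disk_algebra by (simp add: S_o_def disk_algebra_def)
  then show ?thesis using compact_S_op_imp_zero[OF X] by (auto simp: S_o_def)
qed

theorem proposition3p3:
  shows "S_o H_infty sup_norm = {\<lambda>_. 0} \<and> S_o disk_algebra sup_norm = {\<lambda>_. 0}"
  using disk_algebra_subset_H_infty by (simp add: S_o_sup_norm_eq)

end
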